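(* Let $C, A_1,\dots,A_m$ be real symmetric $n\times n$ matrices and let $P = \{x \in \mathbb{R}^m : C - \sum_{i=1}^m A_i x_i \succeq 0\}$ be a bounded spectrahedron that is contained in a halfspace $\{x \in \mathbb{R}^m : w^\top x \le d\}$ with $w \in \mathbb{Z}^m$ and $d \in \mathbb{R}$. Let $K := \{x \in \mathbb{R}^m : w^\top x = d\}$. Then $\mathrm{cl}_{CG}(P) \cap K = \mathrm{cl}_{CG}(P \cap K)$.
   Context: $\succeq 0$ denotes positive semidefiniteness. For a closed convex set $S \subseteq \mathbb{R}^m$, its elementary closure (Chvátal-Gomory closure) is $$\mathrm{cl}_{CG}(S) := \bigcap_{\substack{(c,\delta) \in \mathbb{Z}^m \times \mathbb{R} \\ S \subseteq \{x : c^\top x \le \delta\}}} \{x \in \mathbb{R}^m : c^\top x \le \lfloor \delta \rfloor\}.$$ *)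

theory Defs
  imports "HOL-Analysis.Analysis"
begin

definition psd :: "real ^ 'n ^ 'n \<Rightarrow> bool" where
  "psd M \<longleftrightarrow> transpose M = M \<and> (\<forall>v. 0 \<le> v \<bullet> (M *v v))"

definition spectrahedron :: "real ^ 'n ^ 'n \<Rightarrow> ('m::finite \<Rightarrow> real ^ 'n ^ 'n) \<Rightarrow> (real ^ 'm) set" where
  "spectrahedron C A = {x. psd (C - (\<Sum>i\<in>UNIV. x $ i *\<^sub>R A i))}"

definition integer_vectors :: "(real ^ 'm) set" where
  "integer_vectors = {c. \<forall>i. c $ i \<in> \<int>}"

(* The normal c = 0 is allowed, as for any integer vector; it makes the closure of the empty set empty. *)
definition cl_CG :: "(real ^ 'm) set \<Rightarrow> (real ^ 'm) set" where
  "cl_CG S = (\<Inter>(c, \<delta>) \<in> {(c, \<delta>). c \<in> integer_vectors \<and> S \<subseteq> {x. c \<bullet> x \<le> \<delta>}}.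
                {x. c \<bullet> x \<le> of_int \<lfloor>\<delta>\<rfloor>})"

end

theory Submission
  imports Defs
begin

text \<open>The argument uses only that \<open>P\<close> is compact. For integral \<open>d\<close>, a cut \<open>c \<bullet> x \<le> \<lfloor>\<delta>\<rfloor>\<close> of the face \<open>P \<inter> K\<close>
  is tilted to a cut of \<open>P\<close> with the normal \<open>c + k w\<close>, which has the same trace on \<open>K\<close>. A finite \<open>k\<close> makes
  the tilted inequality valid only up to an arbitrarily small error in the right-hand side, and this error
  vanishes in the rounding because the floor function is right-continuous. If \<open>d\<close> is not integral, both
  sides are empty.\<close>

text \<open>In coordinates, symmetry is a family of linear equations in the entries of
  \<open>M\<close>. For each fixed \<open>v\<close>, nonnegativity of the quadratic form is a weak
  linear inequality in these entries.\<close>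

lemma closed_psd: "closed {M :: real ^ 'n ^ 'n. psd M}"
proof -
  have "{M :: real ^ 'n ^ 'n. psd M} =
      (\<Inter>i. \<Inter>j. {M. M $ j $ i = M $ i $ j}) \<inter> (\<Inter>v. {M. 0 \<le> (\<Sum>i\<in>UNIV. v $ i * (\<Sum>j\<in>UNIV. M $ i $ j * v $ j))})"
    by (auto simp: psd_def vec_eq_iff transpose_def inner_vec_def matrix_vector_mult_def)
  also have "closed \<dots>"
    by (intro closed_Int closed_INT ballI closed_Collect_eq closed_Collect_le continuous_intros)
  finally show ?thesis .
qed

lemma closed_spectrahedron: "closed (spectrahedron C A)"
proof -
  have "spectrahedron C A = (\<lambda>x. C - (\<Sum>i\<in>UNIV. x $ i *\<^sub>R A i)) -` {M. psd M}"
    by (auto simp: spectrahedron_def)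
  also have "closed \<dots>"
    by (intro closed_vimage closed_psd continuous_intros)
  finally show ?thesis .
qed

lemma cl_CG_D:
  assumes "x \<in> cl_CG S" "c \<in> integer_vectors" "\<And>y. y \<in> S \<Longrightarrow> c \<bullet> y \<le> \<delta>"
  shows "c \<bullet> x \<le> of_int \<lfloor>\<delta>\<rfloor>"
  using assms unfolding cl_CG_def by auto

lemma cl_CG_mono: "S \<subseteq> T \<Longrightarrow> cl_CG S \<subseteq> cl_CG T"
  unfolding cl_CG_def by blast

lemma integer_vectors_uminus: "c \<in> integer_vectors \<Longrightarrow> - c \<in> integer_vectors"
  by (simp add: integer_vectors_def)

lemma integer_vectors_add_scaleR:
  assumes "c \<in> integer_vectors" "w \<in> integer_vectors"
  shows "c + of_nat k *\<^sub>R w \<in> integer_vectors"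
  using assms by (simp add: integer_vectors_def)

text \<open>Both \<open>w\<close> and \<open>- w\<close> are normals of valid inequalities, with
  right-hand sides \<open>d\<close> and \<open>- d\<close>, and rounding down only tightens them.
  For non-integral \<open>d\<close> the two cuts contradict each other and the closure is
  empty.\<close>

lemma cl_CG_subset_hyperplane:
  assumes "w \<in> integer_vectors" "S \<subseteq> {x. w \<bullet> x = d}"
  shows "cl_CG S \<subseteq> {x. w \<bullet> x = d}"
proof
  fix x assume x: "x \<in> cl_CG S"
  have "w \<bullet> x \<le> of_int \<lfloor>d\<rfloor>"
    using assms by (intro cl_CG_D[OF x]) auto
  moreover have "- w \<bullet> x \<le> of_int \<lfloor>- d\<rfloor>"
    using assms by (intro cl_CG_D[OF x] integer_vectors_uminus) auto
  ultimately show "x \<in> {x. w \<bullet> x = d}"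
    using of_int_floor_le[of d] of_int_floor_le[of "- d"] unfolding inner_minus_left mem_Collect_eq
    by linarith
qed

text \<open>Where \<open>c \<bullet> x < \<delta>'\<close>, every \<open>k\<close> works. The
  remaining points of \<open>P\<close> form a compact set that misses the face, so
  \<open>w \<bullet> x\<close> stays below \<open>d\<close> by a uniform gap there, and a large
  \<open>k\<close> outweighs the excess of \<open>c \<bullet> x\<close> over
  \<open>\<delta>'\<close>.\<close>

lemma tilted_inequality_valid:
  fixes P :: "'a::real_inner set"
  assumes "compact P" and "P \<subseteq> {x. w \<bullet> x \<le> d}"
    and face: "P \<inter> {x. w \<bullet> x = d} \<subseteq> {x. c \<bullet> x \<le> \<delta>}" and "\<delta> < \<delta>'"
  obtains k :: nat where "P \<subseteq> {x. (c + of_nat k *\<^sub>R w) \<bullet> x \<le> \<delta>' + of_nat k * d}"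
proof -
  \<comment> \<open>The weak inequality makes \<open>Q\<close> closed in \<open>P\<close>, hence
    compact.\<close>
  define Q where "Q = P \<inter> {x. \<delta>' \<le> c \<bullet> x}"
  have "compact Q"
    unfolding Q_def using \<open>compact P\<close>
    by (intro compact_Int_closed closed_Collect_le continuous_intros)
  have outside: "(c + of_nat k *\<^sub>R w) \<bullet> x \<le> \<delta>' + of_nat k * d" if "x \<in> P - Q" for x and k :: nat
  proof -
    have "of_nat k * (w \<bullet> x) \<le> of_nat k * d"
      using that assms(2) by (intro mult_left_mono) auto
    then show ?thesis
      using that by (auto simp: Q_def inner_add_left)
  qed
  show thesis
  proof (cases "Q = {}")
    case True
    then show thesis
      using outside by (intro that[of 0]) blast
  next
    case False
    \<comment> \<open>The maximisers are taken separately: \<open>y\<close> has the smallest gap to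
      the hyperplane, \<open>z\<close> the largest excess over \<open>\<delta>'\<close>. A
      \<open>k\<close> that balances these two worst cases serves all of \<open>Q\<close>.\<close>
    obtain y where y: "y \<in> Q" "\<And>x. x \<in> Q \<Longrightarrow> w \<bullet> x \<le> w \<bullet> y"
      using continuous_attains_sup[OF \<open>compact Q\<close> False, of "\<lambda>x. w \<bullet> x"]
      continuous_on_inner[OF continuous_on_const continuous_on_id] by blast
    obtain z where z: "\<And>x. x \<in> Q \<Longrightarrow> c \<bullet> x \<le> c \<bullet> z"
      using continuous_attains_sup[OF \<open>compact Q\<close> False, of "\<lambda>x. c \<bullet> x"]
      continuous_on_inner[OF continuous_on_const continuous_on_id] by blast
    \<comment> \<open>On the face, \<open>c \<bullet> y \<le> \<delta> < \<delta>'\<close>, which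
      contradicts \<open>y \<in> Q\<close>.\<close>
    have "w \<bullet> y \<noteq> d"
      using y(1) face \<open>\<delta> < \<delta>'\<close> by (force simp: Q_def)
    then have "w \<bullet> y < d"
      using y(1) assms(2) by (force simp: Q_def)
    then obtain k :: nat where k: "c \<bullet> z - \<delta>' < of_nat k * (d - w \<bullet> y)"
      using reals_Archimedean3[of "d - w \<bullet> y"] by auto
    have "(c + of_nat k *\<^sub>R w) \<bullet> x \<le> \<delta>' + of_nat k * d" if "x \<in> Q" for x
    proof -
      have "of_nat k * (w \<bullet> x) \<le> of_nat k * (w \<bullet> y)"
        using y(2)[OF that] by (intro mult_left_mono) auto
      with z[OF that] k show ?thesis
        by (simp add: inner_add_left right_diff_distrib)
    qed
    with outside show thesis
      by (intro that[of k]) blast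
  qed
qed

lemma cl_CG_Int_hyperplane:
  fixes P :: "(real ^ 'm) set"
  assumes "compact P" and w: "w \<in> integer_vectors" and P: "P \<subseteq> {x. w \<bullet> x \<le> d}"
  shows "cl_CG P \<inter> {x. w \<bullet> x = d} = cl_CG (P \<inter> {x. w \<bullet> x = d})"
proof
  show "cl_CG (P \<inter> {x. w \<bullet> x = d}) \<subseteq> cl_CG P \<inter> {x. w \<bullet> x = d}"
    using cl_CG_mono[of "P \<inter> {x. w \<bullet> x = d}" P] cl_CG_subset_hyperplane[OF w, of "P \<inter> {x. w \<bullet> x = d}" d]
    by blast
  show "cl_CG P \<inter> {x. w \<bullet> x = d} \<subseteq> cl_CG (P \<inter> {x. w \<bullet> x = d})"
  proof
    fix x assume "x \<in> cl_CG P \<inter> {x. w \<bullet> x = d}"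
    then have x: "x \<in> cl_CG P" and wx: "w \<bullet> x = d" by auto
    \<comment> \<open>The rounded cut with normal \<open>w\<close> itself holds at \<open>x\<close>,
      where \<open>w \<bullet> x = d\<close>; so a point on the left-hand side exists only for
      integral \<open>d\<close>.\<close>
    have "d \<le> of_int \<lfloor>d\<rfloor>"
      using cl_CG_D[OF x w, of d] P wx by auto
    then have d: "d = of_int \<lfloor>d\<rfloor>"
      using of_int_floor_le[of d] by linarith
    have "c \<bullet> x \<le> of_int \<lfloor>\<delta>\<rfloor>"
      if c: "c \<in> integer_vectors" and face: "P \<inter> {x. w \<bullet> x = d} \<subseteq> {x. c \<bullet> x \<le> \<delta>}" for c \<delta>
    proof -
      \<comment> \<open>Staying below the next integer above \<open>\<delta>\<close> keeps the floor
        unchanged.\<close>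
      obtain \<delta>' where \<delta>': "\<delta> < \<delta>'" "\<delta>' < of_int \<lfloor>\<delta>\<rfloor> + 1"
        using dense[of \<delta> "of_int \<lfloor>\<delta>\<rfloor> + 1"] by auto
      then have fl: "\<lfloor>\<delta>'\<rfloor> = \<lfloor>\<delta>\<rfloor>"
        by linarith
      obtain k :: nat where k: "P \<subseteq> {x. (c + of_nat k *\<^sub>R w) \<bullet> x \<le> \<delta>' + of_nat k * d}"
        using tilted_inequality_valid[OF \<open>compact P\<close> P face \<delta>'(1)] .
      \<comment> \<open>Since \<open>d\<close> is an integer, the shift \<open>k * d\<close> passes
        through the floor, and it later cancels against \<open>k * (w \<bullet> x)\<close>.\<close>
      have "\<delta>' + of_nat k * d = \<delta>' + of_int (int k * \<lfloor>d\<rfloor>)"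
        using d by simp
      then have "\<lfloor>\<delta>' + of_nat k * d\<rfloor> = \<lfloor>\<delta>\<rfloor> + int k * \<lfloor>d\<rfloor>"
        by (simp only: floor_add_int[symmetric] fl)
      moreover have "(c + of_nat k *\<^sub>R w) \<bullet> x \<le> of_int \<lfloor>\<delta>' + of_nat k * d\<rfloor>"
        using k by (intro cl_CG_D[OF x] integer_vectors_add_scaleR c w) auto
      ultimately have "(c + of_nat k *\<^sub>R w) \<bullet> x \<le> of_int \<lfloor>\<delta>\<rfloor> + of_nat k * d"
        using d by simp
      then show ?thesis
        by (simp add: inner_add_left wx)
    qed
    then show "x \<in> cl_CG (P \<inter> {x. w \<bullet> x = d})"
      unfolding cl_CG_def by auto
  qed
qed

theorem theorem3:
  fixes C :: "real ^ 'n ^ 'n" and A :: "'m::finite \<Rightarrow> real ^ 'n ^ 'n"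
    and P K :: "(real ^ 'm) set" and w :: "real ^ 'm" and d :: real
  assumes "transpose C = C" and "\<And>i. transpose (A i) = A i"
    and "P = spectrahedron C A" and "bounded P"
    and "w \<in> integer_vectors" and "P \<subseteq> {x. w \<bullet> x \<le> d}"
    and "K = {x. w \<bullet> x = d}"
  shows "cl_CG P \<inter> K = cl_CG (P \<inter> K)"
proof -
  have "compact P"
    using assms(3,4) closed_spectrahedron by (simp add: compact_eq_bounded_closed)
  then show ?thesis
    using cl_CG_Int_hyperplane assms(5-7) by blast
qed

end
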